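(* Let $\vec a=(a_1,\ldots,a_n)$ be a vector of relatively prime positive integers, let $d_i=\gcd(\vec a_{-i})$ for $1\le i\le n$, and let $p=d_1\cdots d_n$. Then there are constants $C_1,C_2$ (depending on $\vec a$) such that, for all sufficiently large $s\in\mathbb{Z}_{\ge 0}$, writing $k=f(sp)$: \begin{align*} g_{=k}=g_{\le k}&=sp+\sum_{i=1}^n(d_i-1)a_i,\\ h_{=k}=h_{\ge k}&=sp,\\ c_{=k}&=p,\\ c_{\le k}&=sp+C_1,\\ s_{=k}&=sp^2+\sum_{i=1}^n\frac{pa_i(d_i-1)}{2},\\ s_{\le k}&=\frac{1}{2}(sp)^2+\left(\frac{p+\sum_{i=1}^n a_i(d_i-1)}{2}\right)sp+C_2,\\ F_{=k}(x)&=x^{sp}\prod_{i=1}^n\frac{1-x^{d_ia_i}}{1-x^{a_i}},\\ F_{\ge k}(x)&=\frac{x^{sp}}{1-x^p}\prod_{i=1}^n\frac{1-x^{d_ia_i}}{1-x^{a_i}}. \end{align*}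
   Context: For $t\in\mathbb{Z}_{\ge 0}$, $f(t)=f(\vec a;t)=\#\{(x_1,\ldots,x_n)\in\mathbb{Z}_{\ge 0}^n:\ a_1x_1+\cdots+a_nx_n=t\}$. $\vec a_{-i}$ denotes $\vec a$ with the $i$th entry removed. For $k\in\mathbb{Z}_{\ge0}$: $g_{=k}$ (resp. $g_{\le k}$) is the maximum $t\in\mathbb{Z}_{\ge 0}$ with $f(t)=k$ (resp. $f(t)\le k$); $h_{=k}$ (resp. $h_{\ge k}$) is the minimum $t\in\mathbb{Z}_{\ge 0}$ with $f(t)=k$ (resp. $f(t)\ge k$); $c_{=k}$ (resp. $c_{\le k}$) is the number of $t\in\mathbb{Z}_{\ge 0}$ with $f(t)=k$ (resp. $f(t)\le k$); $s_{=k}$ (resp. $s_{\le k}$) is the sum of all $t\in\mathbb{Z}_{\ge 0}$ with $f(t)=k$ (resp. $f(t)\le k$); $F_{=k}(x)=\sum_{t\in\mathbb{Z}_{\ge0}:\,f(t)=k}x^t$ and $F_{\ge k}(x)=\sum_{t\in\mathbb{Z}_{\ge0}:\,f(t)\ge k}x^t$. *)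

theory Defs
  imports Complex_Main "HOL-Computational_Algebra.Formal_Power_Series"
begin

text \<open>
  Vectors are lists, so the entries of \<open>a\<close> are \<open>a ! i\<close> for \<open>i < length a\<close>.
  If all entries of \<open>a\<close> are positive, the set of solutions in \<open>nrep\<close> is finite.
\<close>

definition nrep :: "nat list \<Rightarrow> nat \<Rightarrow> nat" where
  "nrep a t = card {x :: nat list. length x = length a \<and> (\<Sum>i<length a. a ! i * x ! i) = t}"

definition omit :: "nat \<Rightarrow> 'a list \<Rightarrow> 'a list" where
  "omit i a = take i a @ drop (Suc i) a"

text \<open>
  The functions \<open>g\<close>, \<open>c\<close>, \<open>s\<close> have their intended meaning only if the underlying set is finite
  (and nonempty for \<open>g\<close>), and \<open>h\<close> only if it is nonempty.
\<close>

definition g_eq :: "nat list \<Rightarrow> nat \<Rightarrow> nat" where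
  "g_eq a k = Max {t. nrep a t = k}"

definition g_le :: "nat list \<Rightarrow> nat \<Rightarrow> nat" where
  "g_le a k = Max {t. nrep a t \<le> k}"

definition h_eq :: "nat list \<Rightarrow> nat \<Rightarrow> nat" where
  "h_eq a k = (LEAST t. nrep a t = k)"

definition h_ge :: "nat list \<Rightarrow> nat \<Rightarrow> nat" where
  "h_ge a k = (LEAST t. nrep a t \<ge> k)"

definition c_eq :: "nat list \<Rightarrow> nat \<Rightarrow> nat" where
  "c_eq a k = card {t. nrep a t = k}"

definition c_le :: "nat list \<Rightarrow> nat \<Rightarrow> nat" where
  "c_le a k = card {t. nrep a t \<le> k}"

definition s_eq :: "nat list \<Rightarrow> nat \<Rightarrow> nat" where
  "s_eq a k = \<Sum>{t. nrep a t = k}"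

definition s_le :: "nat list \<Rightarrow> nat \<Rightarrow> nat" where
  "s_le a k = \<Sum>{t. nrep a t \<le> k}"

definition F_eq :: "nat list \<Rightarrow> nat \<Rightarrow> real fps" where
  "F_eq a k = Abs_fps (\<lambda>t. if nrep a t = k then 1 else 0)"

definition F_ge :: "nat list \<Rightarrow> nat \<Rightarrow> real fps" where
  "F_ge a k = Abs_fps (\<lambda>t. if nrep a t \<ge> k then 1 else 0)"

end

theory Submission
  imports Defs "HOL-Library.Landau_Symbols" "HOL-Number_Theory.Cong"
    "HOL-Computational_Algebra.Formal_Laurent_Series"
begin

text \<open>
  The \<open>d i\<close> are pairwise coprime, and \<open>d i\<close> divides every entry except \<open>a ! i\<close>, to which it is coprime.
  Hence \<open>d i * a ! i = p * b i\<close> for integers \<open>b i\<close>, any \<open>n - 1\<close> of which are coprime, and the generating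
  function of the numbers of representations factors as
  \<open>(\<Prod>i<n. 1 / (1 - X^(a ! i))) = R(X) H(X^p)\<close> with
  \<open>R(X) = (\<Prod>i<n. (1 - X^(d i * a ! i)) / (1 - X^(a ! i)))\<close> and \<open>H(X) = (\<Prod>i<n. 1 / (1 - X^(b i)))\<close>.
  The exponents of \<open>R\<close> form a complete residue system modulo \<open>p\<close>. So the number of representations
  of \<open>e + p q\<close>, for \<open>e\<close> among these exponents, depends on \<open>q\<close> only, and everything follows once the
  coefficients of \<open>H\<close> are known to be eventually strictly increasing.

  Call a series small if its coefficients are \<open>o(t^(n-2))\<close>. For \<open>i \<noteq> j\<close> the series
  \<open>(1 - X^(b i)) (1 - X^(b j)) H\<close> is small, and the set of \<open>m\<close> for which \<open>(1 - X^m) W\<close> is small is closed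
  under greatest common divisors, so \<open>(1 - X)^2 H\<close> is small. Thus \<open>D = (1 - X) H\<close> varies slowly, while
  its sums over windows of length \<open>b i\<close> and then \<open>b j\<close> count representations of numbers up to \<open>t\<close> by
  the other \<open>n - 2\<close> entries and are at least \<open>c t^(n-2)\<close>. Hence \<open>D\<close> has eventually positive coefficients.
\<close>

section \<open>Growth of coefficients\<close>

definition small_fps :: "nat \<Rightarrow> real fps set" where
  "small_fps k = {w. fps_nth w \<in> o(\<lambda>t. real t ^ k)}"

definition large_fps :: "nat \<Rightarrow> real fps set" where
  "large_fps k = {w. \<exists>c>0. \<forall>t. c * real t ^ k \<le> fps_nth w t}"

lemma small_fps_add: "v \<in> small_fps k \<Longrightarrow> w \<in> small_fps k \<Longrightarrow> v + w \<in> small_fps k"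
  using sum_in_smallo(1)[of "fps_nth v" _ _ "fps_nth w"]
  unfolding small_fps_def mem_Collect_eq fps_add_nth[symmetric] .

lemma small_fps_diff: "v \<in> small_fps k \<Longrightarrow> w \<in> small_fps k \<Longrightarrow> v - w \<in> small_fps k"
  using sum_in_smallo(2)[of "fps_nth v" _ _ "fps_nth w"]
  unfolding small_fps_def mem_Collect_eq fps_sub_nth[symmetric] .

lemma small_fps_0: "0 \<in> small_fps k"
proof -
  have "fps_nth (0 :: real fps) = (\<lambda>_. 0)" by auto
  then show ?thesis by (simp add: small_fps_def)
qed

lemma small_fps_sum: "(\<And>i. i \<in> I \<Longrightarrow> f i \<in> small_fps k) \<Longrightarrow> (\<Sum>i\<in>I. f i) \<in> small_fps k"
  by (induction I rule: infinite_finite_induct) (auto intro: small_fps_add small_fps_0)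

lemma small_fps_of_nat_mult: "w \<in> small_fps k \<Longrightarrow> of_nat m * w \<in> small_fps k"
  using small_fps_sum[of "{..<m}" "\<lambda>_. w"] by simp

lemma small_fps_X_power_mult:
  assumes "w \<in> small_fps k"
  shows "fps_X ^ m * w \<in> small_fps k"
  unfolding small_fps_def mem_Collect_eq
proof (rule landau_o.smallI)
  fix c :: real assume "c > 0"
  then have "\<forall>\<^sub>F t in sequentially. \<bar>fps_nth w t\<bar> \<le> c * real t ^ k"
    using landau_o.smallD[OF assms[unfolded small_fps_def mem_Collect_eq]] by simp
  then have "\<forall>\<^sub>F t in sequentially. \<bar>fps_nth w (t - m)\<bar> \<le> c * real (t - m) ^ k"
    by (rule eventually_compose_filterlim) (rule filterlim_minus_const_nat_at_top)
  then show "\<forall>\<^sub>F t in sequentially. norm (fps_nth (fps_X ^ m * w) t) \<le> c * norm (real t ^ k)"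
  proof eventually_elim
    case (elim t)
    also have "c * real (t - m) ^ k \<le> c * real t ^ k"
      using \<open>c > 0\<close> by (intro mult_left_mono power_mono) auto
    finally show ?case using \<open>c > 0\<close> by (simp add: fps_X_power_mult_nth)
  qed
qed

lemma small_fps_one_minus_X_power_dvd:
  assumes "(1 - fps_X ^ m) * w \<in> small_fps k" and "m dvd n"
  shows "(1 - fps_X ^ n) * w \<in> small_fps k"
proof -
  obtain q where "n = m * q" using assms(2) by (rule dvdE)
  then have "1 - fps_X ^ n = (1 - fps_X ^ m) * (\<Sum>l<q. fps_X ^ (m * l) :: real fps)"
    by (simp only: power_mult one_diff_power_eq)
  then have "(1 - fps_X ^ n) * w = (\<Sum>l<q. fps_X ^ (m * l) * ((1 - fps_X ^ m) * w))"
    by (simp only: mult_ac sum_distrib_left)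
  then show ?thesis using assms(1) by (simp only: small_fps_sum small_fps_X_power_mult)
qed

lemma small_fps_one_minus_X_power_gcd:
  assumes "(1 - fps_X ^ m) * w \<in> small_fps k" and "(1 - fps_X ^ n) * w \<in> small_fps k"
  shows "(1 - fps_X ^ gcd m n) * w \<in> small_fps k"
  using assms
proof (induction m n rule: gcd_nat_induct)
  case (step m n)
  define q where "q = n * (m div n)"
  have "fps_X ^ m = fps_X ^ (m mod n) * (fps_X ^ q :: real fps)"
    unfolding q_def power_add[symmetric] by simp
  then have "(1 - fps_X ^ (m mod n)) * w
      = (1 - fps_X ^ m) * w - fps_X ^ (m mod n) * ((1 - fps_X ^ q) * w)"
    by (simp add: algebra_simps)
  also have "\<dots> \<in> small_fps k"
    using step.prems small_fps_one_minus_X_power_dvd[of n w k q]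
    by (intro small_fps_diff small_fps_X_power_mult) (auto simp: q_def)
  finally show ?case using step by (simp add: gcd_red_nat[of m n])
qed simp

lemma small_fps_one_minus_X_power_Gcd:
  assumes "finite B" and "\<And>m. m \<in> B \<Longrightarrow> (1 - fps_X ^ m) * w \<in> small_fps k"
  shows "(1 - fps_X ^ Gcd B) * w \<in> small_fps k"
  using assms
  by (induction B rule: finite_induct) (simp_all add: small_fps_0 small_fps_one_minus_X_power_gcd)

lemma small_fps_geometric_sum_mult_diff:
  assumes "(1 - fps_X) * w \<in> small_fps k"
  shows "of_nat m * w - (\<Sum>l<m. fps_X ^ l) * w \<in> small_fps k"
proof -
  have "of_nat m * w - (\<Sum>l<m. fps_X ^ l) * w = (\<Sum>l<m. (1 - fps_X ^ l) * w)"
    by (simp add: left_diff_distrib sum_subtractf sum_distrib_right)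
  then show ?thesis
    using assms small_fps_one_minus_X_power_dvd[of 1 w k] by (simp add: small_fps_sum)
qed

lemma partial_sums_abs_smallo:
  fixes v :: "nat \<Rightarrow> real"
  assumes "v \<in> o(\<lambda>t. real t ^ k)"
  shows "(\<lambda>t. \<Sum>i\<le>t. \<bar>v i\<bar>) \<in> o(\<lambda>t. real t ^ Suc k)"
proof (rule landau_o.smallI)
  fix c :: real assume "c > 0"
  then have "\<forall>\<^sub>F t in sequentially. norm (v t) \<le> c / 2 * norm (real t ^ k)"
    using assms by (intro landau_o.smallD) simp_all
  then obtain T where T: "\<And>t. t > T \<Longrightarrow> \<bar>v t\<bar> \<le> c / 2 * real t ^ k"
    by (auto simp: eventually_at_top_dense)
  define M where "M = (\<Sum>i\<le>T. \<bar>v i\<bar>)"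
  have "\<forall>\<^sub>F t in sequentially. M \<le> c / 2 * real t"
    using filterlim_real_sequentially \<open>c > 0\<close>
    by (auto simp: filterlim_at_top field_simps dest: spec[of _ "2 * M / c"])
  then show "\<forall>\<^sub>F t in sequentially. norm (\<Sum>i\<le>t. \<bar>v i\<bar>) \<le> c * norm (real t ^ Suc k)"
    using eventually_gt_at_top[of T]
  proof eventually_elim
    case (elim t)
    have "(\<Sum>i\<in>{T<..t}. \<bar>v i\<bar>) \<le> (\<Sum>i\<in>{T<..t}. c / 2 * real t ^ k)"
    proof (rule sum_mono)
      fix i assume "i \<in> {T<..t}"
      then have "\<bar>v i\<bar> \<le> c / 2 * real i ^ k" and "real i ^ k \<le> real t ^ k"
        using T by (auto intro: power_mono)
      then show "\<bar>v i\<bar> \<le> c / 2 * real t ^ k"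
        using \<open>c > 0\<close> by (meson half_gt_zero less_imp_le mult_left_mono order_trans)
    qed
    also have "\<dots> \<le> c / 2 * real t ^ Suc k"
      using \<open>c > 0\<close> by (simp add: mult_right_mono)
    finally have "(\<Sum>i\<in>{T<..t}. \<bar>v i\<bar>) \<le> c / 2 * real t ^ Suc k" .
    moreover have "c / 2 * real t * 1 \<le> c / 2 * real t * real t ^ k"
      using \<open>c > 0\<close> elim(2) by (intro mult_left_mono one_le_power) auto
    moreover have "(\<Sum>i\<le>t. \<bar>v i\<bar>) = M + (\<Sum>i\<in>{T<..t}. \<bar>v i\<bar>)"
    proof -
      have "{..t} = {..T} \<union> {T<..t}" using elim(2) by auto
      then have "(\<Sum>i\<le>t. \<bar>v i\<bar>) = (\<Sum>i\<in>{..T} \<union> {T<..t}. \<bar>v i\<bar>)" by simp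
      also have "\<dots> = M + (\<Sum>i\<in>{T<..t}. \<bar>v i\<bar>)"
        unfolding M_def by (rule sum.union_disjoint) auto
      finally show ?thesis .
    qed
    ultimately have "(\<Sum>i\<le>t. \<bar>v i\<bar>) \<le> c * real t ^ Suc k" using elim(1) by simp
    then show ?case by (simp add: sum_nonneg)
  qed
qed

lemma one_minus_X_power_neq_0: "b > 0 \<Longrightarrow> (1 - fps_X ^ b :: 'a :: comm_ring_1 fps) \<noteq> 0"
  by (auto simp: fps_eq_iff intro!: exI[of _ 0])

lemma one_minus_X_power_mult_divide:
  fixes v :: "'a :: field fps"
  shows "b > 0 \<Longrightarrow> (1 - fps_X ^ b) * (v / (1 - fps_X ^ b)) = v"
  by (rule dvd_mult_div_cancel[OF unit_imp_dvd]) simp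

lemma fps_nth_divide_one_minus_X_power:
  fixes v :: "'a :: field fps"
  assumes "b > 0"
  shows "fps_nth (v / (1 - fps_X ^ b)) t = (\<Sum>j\<le>t div b. fps_nth v (t - b * j))"
proof (induction t rule: less_induct)
  case (less t)
  define u where "u = v / (1 - fps_X ^ b)"
  have "fps_nth ((1 - fps_X ^ b) * u) t = fps_nth v t"
    unfolding u_def one_minus_X_power_mult_divide[OF assms] ..
  then have u_nth: "fps_nth u t = fps_nth v t + (if t < b then 0 else fps_nth u (t - b))"
    by (simp add: left_diff_distrib fps_X_power_mult_nth diff_eq_eq split: if_splits)
  also have "\<dots> = (\<Sum>j\<le>t div b. fps_nth v (t - b * j))"
  proof (cases "t < b")
    case False
    then have div_Suc: "t div b = Suc ((t - b) div b)" using assms by (simp add: le_div_geq)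
    show ?thesis
      unfolding div_Suc sum.atMost_Suc_shift using False less[of "t - b"] assms by (simp add: u_def)
  qed simp
  finally show ?case by (simp add: u_def)
qed

lemma small_fps_divide_one_minus_X_power:
  assumes "v \<in> small_fps k" and "b > 0"
  shows "v / (1 - fps_X ^ b) \<in> small_fps (Suc k)"
proof -
  have "\<bar>fps_nth (v / (1 - fps_X ^ b)) t\<bar> \<le> (\<Sum>i\<le>t. \<bar>fps_nth v i\<bar>)" for t
  proof -
    have "b * j \<le> t" if "j \<le> t div b" for j
      using that assms(2) by (simp add: less_eq_div_iff_mult_less_eq mult.commute)
    then have inj: "inj_on (\<lambda>j. t - b * j) {..t div b}"
      using assms(2) by (auto simp: inj_on_def) (metis diff_diff_cancel mult_cancel1 not_gr_zero)
    have "\<bar>fps_nth (v / (1 - fps_X ^ b)) t\<bar> \<le> (\<Sum>j\<le>t div b. \<bar>fps_nth v (t - b * j)\<bar>)"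
      unfolding fps_nth_divide_one_minus_X_power[OF assms(2)] by (rule sum_abs)
    also have "\<dots> = (\<Sum>i\<in>(\<lambda>j. t - b * j) ` {..t div b}. \<bar>fps_nth v i\<bar>)"
      by (simp add: sum.reindex[OF inj])
    also have "\<dots> \<le> (\<Sum>i\<le>t. \<bar>fps_nth v i\<bar>)"
      by (intro sum_mono2) auto
    finally show ?thesis .
  qed
  then have "fps_nth (v / (1 - fps_X ^ b)) \<in> O(\<lambda>t. \<Sum>i\<le>t. \<bar>fps_nth v i\<bar>)"
    by (intro landau_o.big_mono always_eventually) (simp add: sum_nonneg)
  also have "(\<lambda>t. \<Sum>i\<le>t. \<bar>fps_nth v i\<bar>) \<in> o(\<lambda>t. real t ^ Suc k)"
    using assms(1) by (intro partial_sums_abs_smallo) (simp add: small_fps_def)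
  finally show ?thesis by (simp add: small_fps_def)
qed

lemma large_fps_divide_one_minus_X_power:
  assumes "v \<in> large_fps k" and "b > 0"
  shows "v / (1 - fps_X ^ b) \<in> large_fps (Suc k)"
proof -
  obtain c where "c > 0" and v_ge: "\<And>t. c * real t ^ k \<le> fps_nth v t"
    using assms(1) by (auto simp: large_fps_def)
  have v_nonneg: "0 \<le> fps_nth v t" for t
    using \<open>c > 0\<close> by (intro order_trans[OF _ v_ge]) simp
  define c' where "c' = c / (2 ^ k * (2 * real b))"
  have "c' * real t ^ Suc k \<le> fps_nth (v / (1 - fps_X ^ b)) t" for t
  proof -
    define m where "m = t div (2 * b)"
    have half: "2 * (b * m) \<le> t"
      unfolding m_def using div_times_less_eq_dividend[of t "2 * b"] by (simp add: mult_ac)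
    have "t < 2 * b * (m + 1)"
      unfolding m_def using assms(2) dividend_less_times_div[of "2 * b" t] by (simp add: algebra_simps)
    then have "real t < real (2 * b * (m + 1))" by (simp only: of_nat_less_iff)
    then have "real t / (2 * real b) \<le> real (m + 1)"
      using assms(2) by (simp add: field_simps)
    then have "real t / (2 * real b) * (c * (real t / 2) ^ k) \<le> real (m + 1) * (c * (real t / 2) ^ k)"
      using \<open>c > 0\<close> by (intro mult_right_mono) auto
    also have "\<dots> = (\<Sum>j\<le>m. c * (real t / 2) ^ k)" by simp
    also have "\<dots> \<le> (\<Sum>j\<le>m. fps_nth v (t - b * j))"
    proof (rule sum_mono)
      fix j assume "j \<in> {..m}"
      then have "b * j \<le> b * m" by simp
      then have "real t / 2 \<le> real (t - b * j)" using half by linarith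
      then have "c * (real t / 2) ^ k \<le> c * real (t - b * j) ^ k"
        using \<open>c > 0\<close> by (intro mult_left_mono power_mono) auto
      then show "c * (real t / 2) ^ k \<le> fps_nth v (t - b * j)" using v_ge order_trans by blast
    qed
    also have "\<dots> \<le> (\<Sum>j\<le>t div b. fps_nth v (t - b * j))"
      using assms(2)
      by (intro sum_mono2) (auto simp: v_nonneg m_def intro: order_trans[OF _ div_le_mono2])
    finally show ?thesis
      by (simp add: fps_nth_divide_one_minus_X_power[OF assms(2)] c'_def power_divide mult_ac)
  qed
  moreover have "c' > 0" using \<open>c > 0\<close> assms(2) by (simp add: c'_def)
  ultimately show ?thesis unfolding large_fps_def by blast
qed

lemma eventually_pos_if_diff_small_fps:
  assumes "w \<in> large_fps k" and "v - w \<in> small_fps k"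
  shows "\<forall>\<^sub>F t in sequentially. fps_nth v t > 0"
proof -
  obtain c where "c > 0" and w_ge: "\<And>t. c * real t ^ k \<le> fps_nth w t"
    using assms(1) by (auto simp: large_fps_def)
  have "\<forall>\<^sub>F t in sequentially. norm (fps_nth (v - w) t) \<le> c / 2 * norm (real t ^ k)"
    using assms(2) \<open>c > 0\<close>
    by (intro landau_o.smallD) (simp_all only: small_fps_def mem_Collect_eq half_gt_zero)
  then show ?thesis
    using eventually_gt_at_top[of 0]
  proof eventually_elim
    case (elim t)
    have "c * real t ^ k > 0" using \<open>c > 0\<close> elim(2) by simp
    moreover have "\<bar>fps_nth v t - fps_nth w t\<bar> \<le> c * real t ^ k / 2" using elim(1) by simp
    ultimately show ?case using w_ge[of t] by linarith
  qed
qed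

section \<open>Denumerants\<close>

definition denumerant_fps :: "('i \<Rightarrow> nat) \<Rightarrow> 'i set \<Rightarrow> real fps" where
  "denumerant_fps b J = inverse (\<Prod>j\<in>J. 1 - fps_X ^ b j)"

lemma denumerant_fps_empty [simp]: "denumerant_fps b {} = 1"
  by (simp add: denumerant_fps_def)

lemma denumerant_fps_insert:
  assumes "finite J" and "j \<notin> J" and "b j > 0"
  shows "denumerant_fps b (insert j J) = denumerant_fps b J / (1 - fps_X ^ b j)"
  using assms by (simp add: denumerant_fps_def fps_inverse_mult fps_divide_unit mult.commute)

lemma denumerant_fps_remove:
  assumes "finite J" and "j \<in> J" and "b j > 0"
  shows "(1 - fps_X ^ b j) * denumerant_fps b J = denumerant_fps b (J - {j})"
  using denumerant_fps_insert[of "J - {j}" j b] assms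
  by (simp add: insert_absorb one_minus_X_power_mult_divide)

lemma denumerant_fps_remove_two:
  assumes "finite J" and "\<And>j. j \<in> J \<Longrightarrow> b j > 0" and "i \<in> J" "j \<in> J" "i \<noteq> j"
  shows "(1 - fps_X ^ b i) * ((1 - fps_X ^ b j) * denumerant_fps b J) = denumerant_fps b (J - {i, j})"
  using assms by (simp add: denumerant_fps_remove flip: Diff_insert2 Diff_insert)

lemma small_fps_denumerant:
  assumes "finite J" and "\<And>j. j \<in> J \<Longrightarrow> b j > 0"
  shows "denumerant_fps b J \<in> small_fps (card J)"
  using assms
proof (induction J rule: finite_induct)
  case empty
  have "\<forall>\<^sub>F t in sequentially. fps_nth (1 :: real fps) t = 0"
    using eventually_gt_at_top[of 0] by eventually_elim simp
  then show ?case by (simp add: small_fps_def landau_o.small.in_cong)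
qed (simp add: denumerant_fps_insert small_fps_divide_one_minus_X_power)

lemma large_fps_cumulative_denumerant:
  assumes "finite J" and "\<And>j. j \<in> J \<Longrightarrow> b j > 0"
  shows "denumerant_fps b J / (1 - fps_X) \<in> large_fps (card J)"
  using assms
proof (induction J rule: finite_induct)
  case empty
  have "fps_nth (1 / (1 - fps_X)) t = (1 :: real)" for t
    by (simp add: fps_divide_unit fps_inverse_one_minus_fps_X)
  then show ?case by (auto simp: large_fps_def intro!: exI[of _ 1])
next
  case (insert j J)
  then have "denumerant_fps b (insert j J) / (1 - fps_X)
      = denumerant_fps b J / (1 - fps_X) / (1 - fps_X ^ b j)"
    by (simp add: denumerant_fps_insert fps_divide_unit mult_ac)
  then show ?case using insert by (simp add: large_fps_divide_one_minus_X_power)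
qed

text \<open>
  A root of unity other than 1 is a pole of order at most \<open>card J - 2\<close> of the generating function;
  the Euclidean algorithm on exponents expresses this without roots of unity.
\<close>

lemma small_fps_second_difference_denumerant:
  assumes "finite J" and pos: "\<And>j. j \<in> J \<Longrightarrow> b j > 0" and "J \<noteq> {}"
    and Gcd: "\<And>i. i \<in> J \<Longrightarrow> Gcd (b ` (J - {i})) = 1"
  shows "(1 - fps_X) * ((1 - fps_X) * denumerant_fps b J) \<in> small_fps (card J - 2)"
proof -
  have one_factor: "(1 - fps_X ^ b i) * ((1 - fps_X) * denumerant_fps b J) \<in> small_fps (card J - 2)"
    if "i \<in> J" for i
  proof -
    have "(1 - fps_X ^ Gcd (b ` (J - {i}))) * ((1 - fps_X ^ b i) * denumerant_fps b J)
        \<in> small_fps (card J - 2)"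
    proof (rule small_fps_one_minus_X_power_Gcd)
      fix m assume "m \<in> b ` (J - {i})"
      then obtain j where j: "m = b j" "j \<in> J" "j \<noteq> i" by auto
      have "denumerant_fps b (J - {j, i}) \<in> small_fps (card (J - {j, i}))"
        using assms(1) pos by (intro small_fps_denumerant) auto
      moreover have "card (J - {j, i}) = card J - 2"
        using that j assms(1) by (simp add: card_Diff_subset)
      ultimately show "(1 - fps_X ^ m) * ((1 - fps_X ^ b i) * denumerant_fps b J)
          \<in> small_fps (card J - 2)"
        using that j assms(1) pos by (simp add: denumerant_fps_remove_two)
    qed (use assms(1) in simp)
    then show ?thesis using Gcd[OF that] by (simp add: mult_ac)
  qed
  obtain i where "i \<in> J" using \<open>J \<noteq> {}\<close> by auto
  have "(1 - fps_X ^ Gcd (b ` (J - {i}))) * ((1 - fps_X) * denumerant_fps b J) \<in> small_fps (card J - 2)"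
    using assms(1) one_factor by (intro small_fps_one_minus_X_power_Gcd) auto
  then show ?thesis using Gcd[OF \<open>i \<in> J\<close>] by simp
qed

lemma large_fps_geometric_sums_mult_denumerant:
  assumes "finite J" and pos: "\<And>j. j \<in> J \<Longrightarrow> b j > 0" and ij: "i \<in> J" "j \<in> J" "i \<noteq> j"
  shows "(\<Sum>l<b i. fps_X ^ l) * ((\<Sum>l<b j. fps_X ^ l) * ((1 - fps_X) * denumerant_fps b J))
    \<in> large_fps (card J - 2)" (is "?w \<in> _")
proof -
  have telescope: "(1 - fps_X) * (\<Sum>l<m. fps_X ^ l) = (1 - fps_X ^ m :: real fps)" for m
    by (rule one_diff_power_eq[symmetric])
  have "(1 - fps_X) * ?w = (1 - fps_X) * (\<Sum>l<b i. fps_X ^ l)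
      * ((1 - fps_X) * (\<Sum>l<b j. fps_X ^ l) * denumerant_fps b J)"
    by (simp only: mult_ac)
  also have "\<dots> = denumerant_fps b (J - {i, j})"
    using assms by (simp add: telescope denumerant_fps_remove_two)
  finally have "?w = denumerant_fps b (J - {i, j}) / (1 - fps_X)"
    using one_minus_X_power_neq_0[of 1]
    by (metis nonzero_mult_div_cancel_left power_one_right zero_less_one)
  moreover have "card (J - {i, j}) = card J - 2"
    using ij assms(1) by (simp add: card_Diff_subset)
  ultimately show ?thesis
    using large_fps_cumulative_denumerant[of "J - {i, j}" b] assms(1) pos by simp
qed

lemma denumerant_fps_eventually_strict_increasing:
  assumes "finite J" and pos: "\<And>j. j \<in> J \<Longrightarrow> b j > 0" and "card J \<ge> 2"
    and Gcd: "\<And>i. i \<in> J \<Longrightarrow> Gcd (b ` (J - {i})) = 1"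
  shows "\<forall>\<^sub>F t in sequentially. fps_nth (denumerant_fps b J) t < fps_nth (denumerant_fps b J) (Suc t)"
proof -
  define k where "k = card J - 2"
  define D where "D = (1 - fps_X) * denumerant_fps b J"
  define S :: "nat \<Rightarrow> real fps" where "S m = (\<Sum>l<m. fps_X ^ l)" for m
  obtain i j where ij: "i \<in> J" "j \<in> J" "i \<noteq> j"
    using assms(1,3) card_le_Suc0_iff_eq[of J] by force
  have diff_small: "(1 - fps_X) * D \<in> small_fps k"
    unfolding D_def k_def using assms by (intro small_fps_second_difference_denumerant) auto
  have "(1 - fps_X) * (S (b j) * D) \<in> small_fps k"
    using small_fps_one_minus_X_power_dvd[of 1 D k "b j"] diff_small
    by (simp add: S_def one_diff_power_eq mult.assoc)
  then have inner: "of_nat (b i) * (S (b j) * D) - S (b i) * (S (b j) * D) \<in> small_fps k"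
    unfolding S_def by (rule small_fps_geometric_sum_mult_diff)
  have outer: "of_nat (b i) * (of_nat (b j) * D - S (b j) * D) \<in> small_fps k"
    unfolding S_def using diff_small by (intro small_fps_of_nat_mult small_fps_geometric_sum_mult_diff)
  have "of_nat (b i) * (of_nat (b j) * D) - S (b i) * (S (b j) * D) \<in> small_fps k"
    using small_fps_add[OF outer inner] by (simp add: right_diff_distrib)
  moreover have "S (b i) * (S (b j) * D) \<in> large_fps k"
    unfolding S_def D_def k_def using assms ij by (intro large_fps_geometric_sums_mult_denumerant) auto
  ultimately have "\<forall>\<^sub>F t in sequentially. fps_nth (of_nat (b i) * (of_nat (b j) * D)) t > 0"
    by (rule eventually_pos_if_diff_small_fps[rotated])
  then have "\<forall>\<^sub>F t in sequentially. fps_nth D (Suc t) > 0"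
    by (subst eventually_sequentially_Suc)
       (auto simp: zero_less_mult_iff fps_of_nat[symmetric] elim!: eventually_mono)
  then show ?thesis
    by eventually_elim (simp add: D_def left_diff_distrib)
qed

section \<open>Representations\<close>

definition representations :: "nat list \<Rightarrow> nat \<Rightarrow> nat list set" where
  "representations a t = {x. length x = length a \<and> (\<Sum>i<length a. a ! i * x ! i) = t}"

lemma nrep_eq_card_representations: "nrep a t = card (representations a t)"
  by (simp add: nrep_def representations_def)

lemma representations_Nil: "representations [] t = (if t = 0 then {[]} else {})"
  by (auto simp: representations_def)

lemma representations_Cons:
  assumes "b > 0"
  shows "representations (b # a) t = (\<Union>y\<le>t div b. (#) y ` representations a (t - b * y))"
proof (rule set_eqI)
  fix x
  show "x \<in> representations (b # a) t \<longleftrightarrow> x \<in> (\<Union>y\<le>t div b. (#) y ` representations a (t - b * y))"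
  proof (cases x)
    case (Cons y ys)
    have "y # ys \<in> representations (b # a) t \<longleftrightarrow> y \<le> t div b \<and> ys \<in> representations a (t - b * y)"
      using assms
      by (auto simp: representations_def sum.lessThan_Suc_shift less_eq_div_iff_mult_less_eq mult.commute
          simp del: sum.lessThan_Suc)
    then show ?thesis using Cons by auto
  qed (auto simp: representations_def)
qed

lemma finite_representations:
  assumes "\<forall>b\<in>set a. b > 0"
  shows "finite (representations a t)"
  using assms by (induction a arbitrary: t) (simp_all add: representations_Nil representations_Cons)

lemma nrep_Cons:
  assumes "b > 0" and "\<forall>c\<in>set a. c > 0"
  shows "nrep (b # a) t = (\<Sum>y\<le>t div b. nrep a (t - b * y))"
proof -
  have "card (\<Union>y\<le>t div b. (#) y ` representations a (t - b * y))
      = (\<Sum>y\<le>t div b. card ((#) y ` representations a (t - b * y)))"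
    using assms(2) by (intro card_UN_disjoint) (auto simp: finite_representations)
  then show ?thesis
    using assms(1) by (simp add: nrep_eq_card_representations representations_Cons card_image)
qed

lemma nrep_map_eq_denumerant_fps:
  assumes "distinct xs" and "\<forall>x\<in>set xs. b x > 0"
  shows "real (nrep (map b xs) t) = fps_nth (denumerant_fps b (set xs)) t"
  using assms
proof (induction xs arbitrary: t)
  case Nil
  show ?case by (simp add: nrep_eq_card_representations representations_Nil)
next
  case (Cons x xs)
  then have "denumerant_fps b (set (x # xs)) = denumerant_fps b (set xs) / (1 - fps_X ^ b x)"
    by (simp add: denumerant_fps_insert)
  then show ?case
    using Cons by (simp add: nrep_Cons fps_nth_divide_one_minus_X_power)
qed

lemma nrep_eq_denumerant_fps:
  assumes "\<forall>i<length a. a ! i > 0"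
  shows "real (nrep a t) = fps_nth (denumerant_fps ((!) a) {..<length a}) t"
  using nrep_map_eq_denumerant_fps[of "[0..<length a]" "(!) a"] assms
  by (simp add: map_nth atLeast0LessThan)

lemma set_omit:
  assumes "i < length a"
  shows "set (omit i a) = (!) a ` ({..<length a} - {i})"
proof -
  have "omit i a = nths a (- {i})"
    unfolding omit_def using assms
    by (subst (3) id_take_nth_drop[OF assms]) (simp add: nths_append nths_Cons nths_all)
  then show ?thesis by (auto simp: set_nths)
qed

theorem nrep_eventually_strict_increasing:
  assumes "length a \<ge> 2" and "\<forall>i<length a. a ! i > 0"
    and "\<forall>i<length a. Gcd (set (omit i a)) = 1"
  shows "\<forall>\<^sub>F t in sequentially. nrep a t < nrep a (Suc t)"
proof -
  have "\<forall>\<^sub>F t in sequentially. fps_nth (denumerant_fps ((!) a) {..<length a}) t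
      < fps_nth (denumerant_fps ((!) a) {..<length a}) (Suc t)"
    using assms by (intro denumerant_fps_eventually_strict_increasing) (simp_all add: set_omit)
  then show ?thesis
    unfolding nrep_eq_denumerant_fps[OF assms(2), symmetric] of_nat_less_iff .
qed

lemma denumerant_fps_compose_X_power:
  assumes "\<And>j. j \<in> J \<Longrightarrow> b j > 0" and "m > 0"
  shows "denumerant_fps b J oo fps_X ^ m = denumerant_fps (\<lambda>j. m * b j) J"
proof -
  have "inverse (1 - fps_X ^ b j) oo fps_X ^ m = inverse (1 - fps_X ^ (m * b j) :: real fps)"
    if "j \<in> J" for j
    using assms(1)[OF that] assms(2)
    by (simp add: fps_inverse_compose fps_compose_sub_distrib fps_X_power_compose power_mult)
  then show ?thesis
    using assms(2) by (simp add: denumerant_fps_def inverse_prod_fps fps_compose_prod_distrib)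
qed

lemma denumerant_fps_rescale:
  assumes "\<And>j. j \<in> J \<Longrightarrow> b j > 0" and "\<And>j. j \<in> J \<Longrightarrow> m j > 0"
  shows "denumerant_fps b J
    = (\<Prod>j\<in>J. (1 - fps_X ^ (m j * b j)) / (1 - fps_X ^ b j)) * denumerant_fps (\<lambda>j. m j * b j) J"
proof -
  have "inverse (1 - fps_X ^ b j)
      = (1 - fps_X ^ (m j * b j)) / (1 - fps_X ^ b j) * inverse (1 - fps_X ^ (m j * b j) :: real fps)"
    if "j \<in> J" for j
    using inverse_mult_eq_1'[of "1 - fps_X ^ (m j * b j) :: real fps"] assms that
    by (simp add: fps_divide_unit mult_ac)
  then show ?thesis
    by (simp add: denumerant_fps_def inverse_prod_fps flip: prod.distrib)
qed

lemma quotient_eq_geometric_sum: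
  assumes "b > 0"
  shows "(1 - fps_X ^ (m * b)) / (1 - fps_X ^ b) = (\<Sum>l<m. fps_X ^ (b * l) :: 'a :: field fps)"
proof -
  have "1 - fps_X ^ (m * b) = (1 - fps_X ^ b) * (\<Sum>l<m. fps_X ^ (b * l) :: 'a fps)"
    by (simp only: mult.commute[of m] power_mult one_diff_power_eq)
  then show ?thesis using one_minus_X_power_neq_0[OF assms, where 'a = 'a] by simp
qed

section \<open>Complete residue systems\<close>

definition indicator_fps :: "nat set \<Rightarrow> real fps" where
  "indicator_fps A = Abs_fps (\<lambda>t. if t \<in> A then 1 else 0)"

lemma fps_nth_indicator_fps [simp]: "fps_nth (indicator_fps A) t = (if t \<in> A then 1 else 0)"
  by (simp add: indicator_fps_def)

lemma indicator_fps_eq_sum: "finite A \<Longrightarrow> indicator_fps A = (\<Sum>t\<in>A. fps_X ^ t)"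
  by (rule fps_ext) (simp add: fps_sum_nth fps_X_power_nth)

lemma indicator_fps_Un_disjoint:
  "A \<inter> B = {} \<Longrightarrow> indicator_fps (A \<union> B) = indicator_fps A + indicator_fps B"
  by (rule fps_ext) auto

lemma indicator_fps_translate: "indicator_fps ((+) m ` A) = fps_X ^ m * indicator_fps A"
proof (rule fps_ext)
  fix t
  have "t \<in> (+) m ` A \<longleftrightarrow> m \<le> t \<and> t - m \<in> A"
    by (metis diff_add_inverse image_iff le_add1 le_add_diff_inverse)
  then show "fps_nth (indicator_fps ((+) m ` A)) t = fps_nth (fps_X ^ m * indicator_fps A) t"
    by (simp add: fps_X_power_mult_nth not_less)
qed

text \<open>
  Every integer is uniquely \<open>q p + e\<close> with \<open>e \<in> E\<close> and an integer \<open>q\<close>; \<open>gaps\<close> are the natural numbers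
  for which \<open>q\<close> is negative.
\<close>

locale complete_residue_system =
  fixes p :: nat and E :: "nat set"
  assumes zero_mem: "0 \<in> E" and bij_mod: "bij_betw (\<lambda>e. e mod p) E {..<p}"
begin

definition block :: "nat \<Rightarrow> nat set" where
  "block q = (+) (q * p) ` E"

definition gaps :: "nat set" where
  "gaps = - (\<Union>q. block q)"

lemma modulus_pos: "p > 0"
  using zero_mem bij_betw_apply[OF bij_mod] by fastforce

lemma finite_residues: "finite E"
  using bij_betw_finite[OF bij_mod] by simp

lemma card_residues: "card E = p"
  using bij_betw_same_card[OF bij_mod] by simp

lemma residue_le_Max: "e \<in> E \<Longrightarrow> e \<le> Max E"
  using finite_residues by simp

lemma Max_mem: "Max E \<in> E"
  using finite_residues zero_mem by (intro Max_in) auto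

lemma residue_eqI: "e \<in> E \<Longrightarrow> e' \<in> E \<Longrightarrow> e mod p = e' mod p \<Longrightarrow> e = e'"
  using bij_betw_imp_inj_on[OF bij_mod] by (rule inj_onD)

lemma decomposition_unique:
  assumes "q * p + e = q' * p + e'" and "e \<in> E" "e' \<in> E"
  shows "q = q'" and "e = e'"
proof -
  show "e = e'" using assms residue_eqI by (metis mod_mult_self3)
  then show "q = q'" using assms(1) modulus_pos by simp
qed

lemma mem_block_iff: "t \<in> block q \<Longrightarrow> t \<in> block q' \<longleftrightarrow> q' = q"
  using decomposition_unique(1) by (auto simp: block_def)

lemma gap_not_block: "t \<in> gaps \<Longrightarrow> t \<notin> block q"
  by (simp add: gaps_def)

lemma gap_or_block: obtains (gap) "t \<in> gaps" | (block) q where "t \<in> block q"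
  by (auto simp: gaps_def)

lemma block_lower: "t \<in> block q \<Longrightarrow> q * p \<le> t"
  by (auto simp: block_def)

lemma block_upper: "t \<in> block q \<Longrightarrow> t \<le> q * p + Max E"
  using residue_le_Max by (auto simp: block_def)

lemma lower_mem_block: "q * p \<in> block q"
  using zero_mem by (force simp: block_def)

lemma upper_mem_block: "q * p + Max E \<in> block q"
  using Max_mem by (simp add: block_def)

lemma mem_blockI:
  assumes "e \<in> E" "e \<le> t" "p dvd t - e"
  shows "t \<in> block ((t - e) div p)"
  using assms by (force simp: block_def)

lemma gap_less_Max:
  assumes "t \<in> gaps"
  shows "t < Max E"
proof -
  have "t mod p \<in> (\<lambda>e. e mod p) ` E"
    using bij_betw_imp_surj_on[OF bij_mod] modulus_pos by simp
  then obtain e where "e \<in> E" and e_mod: "e mod p = t mod p" by force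
  have "\<not> e \<le> t"
    using assms mem_blockI[OF \<open>e \<in> E\<close>, of t] mod_eq_dvd_iff_nat[of e t p] e_mod
    by (auto simp: gaps_def)
  then show ?thesis using residue_le_Max[OF \<open>e \<in> E\<close>] by simp
qed

lemma finite_gaps: "finite gaps"
  by (rule finite_subset[of _ "{..<Max E}"]) (auto dest: gap_less_Max)

lemma finite_block: "finite (block q)"
  by (simp add: block_def finite_residues)

lemma card_block: "card (block q) = p"
  by (simp add: block_def card_image card_residues)

lemma sum_block: "\<Sum>(block q) = q * p * p + \<Sum>E"
  by (simp add: block_def sum.reindex sum.distrib card_residues)

lemma sum_gaps_Un_blocks:
  "(\<Sum>t\<in>gaps \<union> (\<Union>q\<le>s. block q). g t) = (\<Sum>t\<in>gaps. g t) + (\<Sum>q\<le>s. \<Sum>t\<in>block q. g t)"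
proof -
  have "gaps \<inter> (\<Union>q\<le>s. block q) = {}" using gap_not_block by blast
  then have "(\<Sum>t\<in>gaps \<union> (\<Union>q\<le>s. block q). g t) = (\<Sum>t\<in>gaps. g t) + (\<Sum>t\<in>(\<Union>q\<le>s. block q). g t)"
    by (intro sum.union_disjoint) (simp_all add: finite_gaps finite_block)
  also have "(\<Sum>t\<in>(\<Union>q\<le>s. block q). g t) = (\<Sum>q\<le>s. \<Sum>t\<in>block q. g t)"
    using mem_block_iff by (intro sum.UNION_disjoint) (auto simp: finite_block)
  finally show ?thesis .
qed

lemma card_gaps_Un_blocks: "card (gaps \<union> (\<Union>q\<le>s. block q)) = s * p + (card gaps + p)"
  using sum_gaps_Un_blocks[of "\<lambda>_. 1 :: nat" s] by (simp add: card_block)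

lemma twice_sum_gaps_Un_blocks:
  "2 * \<Sum>(gaps \<union> (\<Union>q\<le>s. block q)) = (s * p)\<^sup>2 + p * (s * p) + 2 * s * \<Sum>E + 2 * (\<Sum>gaps + \<Sum>E)"
proof -
  have "2 * (\<Sum>q\<le>s. q * p * p + \<Sum>E) = (s * p)\<^sup>2 + p * (s * p) + 2 * s * \<Sum>E + 2 * \<Sum>E"
    by (induction s) (simp_all add: power2_eq_square algebra_simps)
  then show ?thesis by (simp add: sum_gaps_Un_blocks sum_block)
qed

lemma indicator_fps_block: "indicator_fps (block q) = fps_X ^ (q * p) * indicator_fps E"
  by (simp add: block_def indicator_fps_translate)

lemma indicator_fps_blocks_from:
  "indicator_fps (\<Union>q\<in>{s..}. block q) = fps_X ^ (s * p) / (1 - fps_X ^ p) * indicator_fps E"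
proof -
  define U where "U = (\<Union>q\<in>{s..}. block q)"
  have "block (Suc q) = (+) p ` block q" for q
    by (simp add: block_def image_image add.assoc)
  moreover have "{Suc s..} = Suc ` {s..}"
    using image_add_atLeast[of 1 s] by simp
  ultimately have translate: "(+) p ` U = (\<Union>q\<in>{Suc s..}. block q)"
    by (simp add: U_def image_UN)
  have "{s..} = insert s {Suc s..}" by auto
  then have "U = block s \<union> (+) p ` U" unfolding translate unfolding U_def by simp
  moreover have "block s \<inter> (+) p ` U = {}"
    unfolding translate by (auto simp: mem_block_iff[of _ s])
  ultimately have "indicator_fps U = fps_X ^ (s * p) * indicator_fps E + fps_X ^ p * indicator_fps U"
    by (metis indicator_fps_Un_disjoint indicator_fps_block indicator_fps_translate)
  then have "(1 - fps_X ^ p) * indicator_fps U = fps_X ^ (s * p) * indicator_fps E"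
    unfolding left_diff_distrib mult_1_left diff_eq_eq .
  then have "indicator_fps U = fps_X ^ (s * p) * indicator_fps E / (1 - fps_X ^ p)"
    using one_minus_X_power_neq_0[OF modulus_pos] by (metis nonzero_mult_div_cancel_left)
  then show ?thesis using modulus_pos by (simp add: U_def fps_divide_unit mult_ac)
qed

lemma
  shows fps_nth_indicator_mult_compose_block:
      "t \<in> block q \<Longrightarrow> fps_nth (indicator_fps E * (h oo fps_X ^ p)) t = fps_nth h q"
    and fps_nth_indicator_mult_compose_gap:
      "t \<in> gaps \<Longrightarrow> fps_nth (indicator_fps E * (h oo fps_X ^ p)) t = 0"
proof -
  have coefficient: "fps_nth (indicator_fps E * (h oo fps_X ^ p)) t
      = (\<Sum>e=0..t. if e \<in> E \<and> p dvd t - e then fps_nth h ((t - e) div p) else 0)"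
    unfolding fps_mult_nth by (intro sum.cong refl) (auto simp: fps_nth_compose_X_power)
  show "fps_nth (indicator_fps E * (h oo fps_X ^ p)) t = 0" if "t \<in> gaps"
    unfolding coefficient using that by (intro sum.neutral) (auto simp: gaps_def dest: mem_blockI)
  show "fps_nth (indicator_fps E * (h oo fps_X ^ p)) t = fps_nth h q" if "t \<in> block q"
  proof -
    obtain r where "r \<in> E" and t_eq: "t = q * p + r" using \<open>t \<in> block q\<close> by (auto simp: block_def)
    have "e = r" if "e \<in> E" "e \<le> t" "p dvd t - e" for e
      using that \<open>r \<in> E\<close> decomposition_unique(2)[of _ e q r] unfolding t_eq
      by (metis dvd_div_mult_self le_add_diff_inverse2)
    then have "(\<Sum>e=0..t. if e \<in> E \<and> p dvd t - e then fps_nth h ((t - e) div p) else 0)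
        = (\<Sum>e=0..t. if e = r then fps_nth h q else 0)"
      using \<open>r \<in> E\<close> modulus_pos t_eq by (intro sum.cong refl) auto
    then show ?thesis unfolding coefficient by (simp add: t_eq)
  qed
qed

end

section \<open>Level sets of functions constant on blocks\<close>

definition pivot :: "(nat \<Rightarrow> nat) \<Rightarrow> nat \<Rightarrow> bool" where
  "pivot f s \<longleftrightarrow> (\<forall>q. (f q \<le> f s \<longleftrightarrow> q \<le> s) \<and> (f s \<le> f q \<longleftrightarrow> s \<le> q))"

lemma eventually_pivot:
  fixes f :: "nat \<Rightarrow> nat"
  assumes "\<forall>\<^sub>F t in sequentially. f t < f (Suc t)"
  shows "\<forall>\<^sub>F s in sequentially. pivot f s"
proof -
  obtain T where increase: "\<And>t. t \<ge> T \<Longrightarrow> f t < f (Suc t)"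
    using assms by (auto simp: eventually_sequentially)
  then have mono: "strict_mono (\<lambda>j. f (T + j))" by (simp add: strict_mono_Suc_iff)
  have less_iff: "f x < f y \<longleftrightarrow> x < y" if "T \<le> x" "T \<le> y" for x y
    using strict_mono_less[OF mono, of "x - T" "y - T"] that by (simp add: less_diff_iff)
  define M where "M = Max (f ` {..T})"
  have initial_le: "f q \<le> M" if "q \<le> T" for q unfolding M_def using that by (intro Max_ge) auto
  have "pivot f s" if "s \<ge> T + M + 1" for s
  proof -
    have "s - T \<le> f s" using strict_mono_imp_increasing[OF mono, of "s - T"] that by simp
    then have "M < f s" using that by simp
    then have "(f q < f s \<longleftrightarrow> q < s) \<and> (f s < f q \<longleftrightarrow> s < q)" for q
      using initial_le[of q] less_iff[of q s] less_iff[of s q] that by (cases "q \<le> T") auto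
    then show ?thesis by (simp add: pivot_def flip: not_less)
  qed
  then show ?thesis unfolding eventually_sequentially by blast
qed

locale block_function = complete_residue_system +
  fixes F f :: "nat \<Rightarrow> nat"
  assumes eq_on_block: "t \<in> block q \<Longrightarrow> F t = f q" and eq_0_on_gaps: "t \<in> gaps \<Longrightarrow> F t = 0"
begin

lemma Collect_eq_gaps_Un_blocks:
  "{t. P (F t)} = {t \<in> gaps. P 0} \<union> (\<Union>q\<in>{q. P (f q)}. block q)"
proof (rule set_eqI)
  fix t
  show "t \<in> {t. P (F t)} \<longleftrightarrow> t \<in> {t \<in> gaps. P 0} \<union> (\<Union>q\<in>{q. P (f q)}. block q)"
  proof (cases t rule: gap_or_block)
    case gap
    then show ?thesis by (simp add: eq_0_on_gaps gap_not_block)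
  next
    case (block q)
    then have "t \<notin> gaps" using gap_not_block by blast
    then show ?thesis using block by (simp add: eq_on_block mem_block_iff)
  qed
qed

context
  fixes s assumes pivot: "pivot f s" and s_pos: "s > 0"
begin

lemma value_at_lower: "F (s * p) = f s"
  using lower_mem_block by (rule eq_on_block)

lemma value_le_iff: "f q \<le> f s \<longleftrightarrow> q \<le> s" and value_ge_iff: "f s \<le> f q \<longleftrightarrow> s \<le> q"
  using pivot by (auto simp: pivot_def)

lemma value_pos: "f s > 0"
  using value_le_iff[of 0] value_ge_iff[of 0] s_pos by linarith

lemma value_eq_iff: "f q = f s \<longleftrightarrow> q = s"
  using value_le_iff[of q] value_ge_iff[of q] by auto

lemma sublevel_set_eq: "{t. F t \<le> F (s * p)} = gaps \<union> (\<Union>q\<le>s. block q)"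
  using Collect_eq_gaps_Un_blocks[of "\<lambda>m. m \<le> F (s * p)"]
  by (simp add: value_at_lower value_le_iff atMost_def)

lemma superlevel_set_eq: "{t. F t \<ge> F (s * p)} = (\<Union>q\<in>{s..}. block q)"
  using Collect_eq_gaps_Un_blocks[of "\<lambda>m. m \<ge> F (s * p)"] value_pos
  by (simp add: value_at_lower value_ge_iff atLeast_def)

lemma level_set_eq: "{t. F t = F (s * p)} = block s"
  using Collect_eq_gaps_Un_blocks[of "\<lambda>m. m = F (s * p)"] value_pos
  by (simp add: value_at_lower value_eq_iff)

lemma finite_sublevel_set: "finite {t. F t \<le> F (s * p)}"
  by (simp add: sublevel_set_eq finite_gaps finite_block)

lemma Max_level_set: "Max {t. F t = F (s * p)} = s * p + Max E"
  unfolding level_set_eq by (rule Max_eqI) (auto simp: finite_block block_upper upper_mem_block)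

lemma Max_sublevel_set: "Max {t. F t \<le> F (s * p)} = s * p + Max E"
proof (rule Max_eqI[OF finite_sublevel_set])
  fix t assume "t \<in> {t. F t \<le> F (s * p)}"
  then consider (gap) "t \<in> gaps" | (block) q where "q \<le> s" "t \<in> block q"
    unfolding sublevel_set_eq by auto
  then show "t \<le> s * p + Max E"
  proof cases
    case gap
    then show ?thesis using gap_less_Max by fastforce
  next
    case block
    then have "t \<le> q * p + Max E" "q * p \<le> s * p" by (simp_all add: block_upper)
    then show ?thesis by linarith
  qed
qed (unfold sublevel_set_eq, use upper_mem_block in auto)

lemma Least_level_set: "(LEAST t. F t = F (s * p)) = s * p"
  using level_set_eq block_lower by (intro Least_equality) auto

lemma Least_superlevel_set: "(LEAST t. F t \<ge> F (s * p)) = s * p"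
proof (rule Least_equality)
  fix t assume "F t \<ge> F (s * p)"
  then obtain q where "s \<le> q" "t \<in> block q" using superlevel_set_eq by blast
  then show "s * p \<le> t" using block_lower by (meson mult_le_mono1 order_trans)
qed simp

end

end

lemma F_eq_eq_indicator_fps: "F_eq a k = indicator_fps {t. nrep a t = k}"
  by (simp add: F_eq_def indicator_fps_def)

lemma F_ge_eq_indicator_fps: "F_ge a k = indicator_fps {t. nrep a t \<ge> k}"
  by (simp add: F_ge_def indicator_fps_def)

section \<open>Coprime vectors\<close>

locale coprime_vector =
  fixes a :: "nat list" and n p :: nat and d :: "nat \<Rightarrow> nat"
  assumes len: "length a = n" and n_ge_2: "n \<ge> 2"
    and pos: "\<forall>i<n. a ! i > 0"
    and Gcd_a: "Gcd (set a) = 1"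
    and d_eq: "\<forall>i<n. d i = Gcd (set (omit i a))"
    and p_eq: "p = (\<Prod>i<n. d i)"
begin

lemma dvd_d_iff:
  assumes "i < n"
  shows "m dvd d i \<longleftrightarrow> (\<forall>j<n. j \<noteq> i \<longrightarrow> m dvd a ! j)"
proof -
  have "m dvd d i \<longleftrightarrow> (\<forall>x\<in>(!) a ` ({..<n} - {i}). m dvd x)"
    using d_eq assms set_omit[of i a] len by (simp only: dvd_Gcd_iff)
  then show ?thesis by blast
qed

lemma d_dvd: "i < n \<Longrightarrow> j < n \<Longrightarrow> j \<noteq> i \<Longrightarrow> d i dvd a ! j"
  using dvd_d_iff[of i "d i"] by simp

lemma d_pos:
  assumes "i < n"
  shows "d i > 0"
proof -
  obtain j where "j < n" "j \<noteq> i"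
    using n_ge_2 that[of 0] that[of 1] by (cases "i = 0") auto
  then have "d i dvd a ! j" "a ! j > 0" using d_dvd[OF assms] pos by auto
  then show ?thesis using dvd_pos_nat by blast
qed

lemma d_dvd_p: "i < n \<Longrightarrow> d i dvd p"
  unfolding p_eq by (intro dvd_prodI) auto

lemma p_pos: "p > 0"
  using d_pos by (auto simp: p_eq intro: prod_pos)

lemma coprime_d_a:
  assumes "i < n"
  shows "coprime (d i) (a ! i)"
proof (rule coprimeI)
  fix m assume m_dvd: "m dvd d i" "m dvd a ! i"
  have "m dvd x" if "x \<in> set a" for x
  proof -
    obtain j where "j < n" "x = a ! j" using \<open>x \<in> set a\<close> len by (metis in_set_conv_nth)
    then show ?thesis using m_dvd dvd_d_iff[OF assms, of m] by metis
  qed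
  then have "m dvd Gcd (set a)" by (rule Gcd_greatest)
  then show "is_unit m" unfolding Gcd_a .
qed

lemma coprime_d_d: "i < n \<Longrightarrow> j < n \<Longrightarrow> i \<noteq> j \<Longrightarrow> coprime (d i) (d j)"
  by (rule coprime_divisors[OF dvd_refl d_dvd coprime_d_a])

definition reduced :: "nat \<Rightarrow> nat" where
  "reduced i = d i * a ! i div p"

lemma p_mult_reduced:
  assumes "i < n"
  shows "p * reduced i = d i * a ! i"
proof -
  have "[d i * a ! i = 0] (mod (\<Prod>j<n. d j))"
  proof (rule coprime_cong_prod_nat)
    fix j assume "j \<in> {..<n}"
    then have "d j dvd d i * a ! i" using d_dvd[of j i] assms by (cases "j = i") auto
    then show "[d i * a ! i = 0] (mod d j)" by (simp add: cong_0_iff)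
  qed (simp add: coprime_d_d)
  then show ?thesis by (simp add: reduced_def cong_0_iff flip: p_eq)
qed

lemma reduced_pos: "i < n \<Longrightarrow> reduced i > 0"
  using p_mult_reduced[of i] d_pos[of i] pos by (metis mult_0_right mult_pos_pos not_gr_zero)

lemma Gcd_reduced:
  assumes "i < n"
  shows "Gcd (reduced ` ({..<n} - {i})) = 1"
proof -
  define m where "m = Gcd (reduced ` ({..<n} - {i}))"
  have "m * d i dvd a ! j" if j: "j < n" "j \<noteq> i" for j
  proof -
    have "d i * d j dvd p"
      using assms j by (intro divides_mult d_dvd_p coprime_d_d) auto
    moreover have "m dvd reduced j" unfolding m_def using j by (intro Gcd_dvd) auto
    ultimately have "(d i * d j) * m dvd p * reduced j" by (rule mult_dvd_mono)
    then have "d j * (m * d i) dvd d j * a ! j"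
      unfolding p_mult_reduced[OF \<open>j < n\<close>] by (simp only: mult_ac)
    then show ?thesis using d_pos[OF \<open>j < n\<close>] by simp
  qed
  then have "m * d i dvd d i" using dvd_d_iff[OF assms] by blast
  then show ?thesis using d_pos[OF assms] by (simp add: m_def)
qed

definition reduced_vector :: "nat list" where
  "reduced_vector = map reduced [0..<n]"

lemma nrep_reduced_vector: "real (nrep reduced_vector q) = fps_nth (denumerant_fps reduced {..<n}) q"
  unfolding reduced_vector_def using nrep_map_eq_denumerant_fps[of "[0..<n]" reduced] reduced_pos
  by (simp add: atLeast0LessThan)

lemma nrep_reduced_vector_eventually_strict_increasing:
  "\<forall>\<^sub>F q in sequentially. nrep reduced_vector q < nrep reduced_vector (Suc q)"
proof (rule nrep_eventually_strict_increasing)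
  have "set (omit i reduced_vector) = reduced ` ({..<n} - {i})" if "i < n" for i
    using set_omit[of i reduced_vector] that by (auto simp: reduced_vector_def)
  then show "\<forall>i<length reduced_vector. Gcd (set (omit i reduced_vector)) = 1"
    using Gcd_reduced by (simp add: reduced_vector_def)
qed (use n_ge_2 reduced_pos in \<open>simp_all add: reduced_vector_def\<close>)

definition digits :: "(nat \<Rightarrow> nat) set" where
  "digits = (\<Pi>\<^sub>E i\<in>{..<n}. {..<d i})"

definition digits_value :: "(nat \<Rightarrow> nat) \<Rightarrow> nat" where
  "digits_value r = (\<Sum>i<n. a ! i * r i)"

definition residues :: "nat set" where
  "residues = digits_value ` digits"

definition max_residue :: nat where
  "max_residue = (\<Sum>i<n. a ! i * (d i - 1))"

lemma digits_less: "r \<in> digits \<Longrightarrow> i < n \<Longrightarrow> r i < d i"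
  by (auto simp: digits_def)

lemma card_digits: "card digits = p"
  unfolding digits_def p_eq by (simp add: card_PiE)

lemma digits_value_cong:
  assumes "i < n"
  shows "[digits_value r = a ! i * r i] (mod d i)"
proof -
  have "d i dvd (\<Sum>j\<in>{..<n} - {i}. a ! j * r j)"
    using d_dvd[OF assms] by (intro dvd_sum) auto
  then have "[a ! i * r i + (\<Sum>j\<in>{..<n} - {i}. a ! j * r j) = a ! i * r i + 0] (mod d i)"
    by (intro cong_add cong_refl) (simp add: cong_0_iff)
  then show ?thesis using assms by (simp add: digits_value_def sum.remove[of "{..<n}" i])
qed

lemma inj_on_digits_value_mod: "inj_on (\<lambda>r. digits_value r mod p) digits"
proof (rule inj_onI)
  fix r r' assume digits: "r \<in> digits" "r' \<in> digits" and "digits_value r mod p = digits_value r' mod p"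
  then have value_cong: "[digits_value r = digits_value r'] (mod p)" by (simp add: cong_def)
  show "r = r'"
  proof (rule PiE_ext)
    fix i assume "i \<in> {..<n}"
    then have "i < n" by simp
    have "[digits_value r = digits_value r'] (mod d i)"
      using value_cong d_dvd_p[OF \<open>i < n\<close>] cong_dvd_modulus_nat by blast
    then have "[a ! i * r i = a ! i * r' i] (mod d i)"
      using digits_value_cong[OF \<open>i < n\<close>] cong_trans cong_sym by meson
    then have "[r i = r' i] (mod d i)"
      using coprime_d_a[OF \<open>i < n\<close>] by (simp add: cong_mult_lcancel_nat coprime_commute)
    then show "r i = r' i"
      using digits_less[OF digits(1) \<open>i < n\<close>] digits_less[OF digits(2) \<open>i < n\<close>]
      by (rule cong_less_modulus_unique_nat)
  qed (use digits in \<open>simp_all add: digits_def\<close>)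
qed

lemma inj_on_digits_value: "inj_on digits_value digits"
  using inj_on_digits_value_mod by (rule inj_on_imageI2[of "\<lambda>e. e mod p", unfolded comp_def])

sublocale complete_residue_system p residues
proof
  have "(\<lambda>i\<in>{..<n}. 0) \<in> digits" using d_pos by (auto simp: digits_def)
  moreover have "digits_value (\<lambda>i\<in>{..<n}. 0) = 0" by (simp add: digits_value_def)
  ultimately show "0 \<in> residues" unfolding residues_def by (metis imageI)
  have "inj_on (\<lambda>e. e mod p) residues"
    unfolding residues_def using inj_on_digits_value_mod by (intro inj_on_imageI) (simp add: comp_def)
  moreover have "(\<lambda>e. e mod p) ` residues = {..<p}"
  proof (rule card_subset_eq)
    show "(\<lambda>e. e mod p) ` residues \<subseteq> {..<p}" using p_pos by auto
    show "card ((\<lambda>e. e mod p) ` residues) = card {..<p}"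
      using card_image[OF inj_on_digits_value_mod] by (simp add: residues_def image_image card_digits)
  qed simp
  ultimately show "bij_betw (\<lambda>e. e mod p) residues {..<p}" by (simp add: bij_betw_def)
qed

lemma indicator_fps_residues:
  "indicator_fps residues = (\<Prod>i<n. (1 - fps_X ^ (d i * a ! i)) / (1 - fps_X ^ (a ! i)))"
proof -
  have "indicator_fps residues = (\<Sum>r\<in>digits. fps_X ^ digits_value r)"
    using finite_residues inj_on_digits_value
    by (simp add: indicator_fps_eq_sum residues_def sum.reindex)
  also have "\<dots> = (\<Sum>r\<in>digits. \<Prod>i<n. fps_X ^ (a ! i * r i))"
    by (simp add: digits_value_def power_sum)
  also have "\<dots> = (\<Prod>i<n. \<Sum>l<d i. fps_X ^ (a ! i * l))"
    unfolding digits_def by (rule prod_sum_PiE[symmetric]) auto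
  also have "\<dots> = (\<Prod>i<n. (1 - fps_X ^ (d i * a ! i)) / (1 - fps_X ^ (a ! i)))"
    using pos by (intro prod.cong refl quotient_eq_geometric_sum[symmetric]) simp
  finally show ?thesis .
qed

lemma denumerant_fps_factorization:
  "denumerant_fps ((!) a) {..<n}
    = indicator_fps residues * (denumerant_fps reduced {..<n} oo fps_X ^ p)"
proof -
  have "denumerant_fps (\<lambda>i. d i * a ! i) {..<n} = denumerant_fps (\<lambda>i. p * reduced i) {..<n}"
    unfolding denumerant_fps_def by (simp add: p_mult_reduced)
  also have "\<dots> = denumerant_fps reduced {..<n} oo fps_X ^ p"
    using reduced_pos p_pos by (intro denumerant_fps_compose_X_power[symmetric]) auto
  finally show ?thesis
    using denumerant_fps_rescale[of "{..<n}" "(!) a" d] pos d_pos by (simp add: indicator_fps_residues)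
qed

sublocale block_function p residues "nrep a" "nrep reduced_vector"
proof
  have nrep_eq: "real (nrep a t)
      = fps_nth (indicator_fps residues * (denumerant_fps reduced {..<n} oo fps_X ^ p)) t" for t
    using nrep_eq_denumerant_fps[of a t] pos len by (simp add: denumerant_fps_factorization)
  show "nrep a t = nrep reduced_vector q" if "t \<in> block q" for t q
    using nrep_eq[of t] fps_nth_indicator_mult_compose_block[OF that]
    by (simp flip: nrep_reduced_vector)
  show "nrep a t = 0" if "t \<in> gaps" for t
    using nrep_eq[of t] fps_nth_indicator_mult_compose_gap[OF that] by simp
qed

lemma Max_residues: "Max residues = max_residue"
proof (rule Max_eqI)
  fix e assume "e \<in> residues"
  then obtain r where "r \<in> digits" "e = digits_value r" by (auto simp: residues_def)
  then show "e \<le> max_residue"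
    unfolding digits_value_def max_residue_def
    by (auto intro!: sum_mono mult_left_mono dest!: digits_less simp: less_eq_Suc_le)
next
  have "(\<lambda>i\<in>{..<n}. d i - 1) \<in> digits" using d_pos by (auto simp: digits_def)
  moreover have "digits_value (\<lambda>i\<in>{..<n}. d i - 1) = max_residue"
    by (simp add: digits_value_def max_residue_def)
  ultimately show "max_residue \<in> residues" unfolding residues_def by (metis imageI)
qed (rule finite_residues)

text \<open>Complementing the digits permutes \<open>residues\<close> by \<open>e \<mapsto> max_residue - e\<close>.\<close>

lemma twice_sum_residues: "2 * \<Sum>residues = p * max_residue"
proof -
  define flip where "flip r = (\<lambda>i\<in>{..<n}. d i - 1 - r i)" for r
  have flip_digits: "flip r \<in> digits" for r
    using d_pos by (auto simp: flip_def digits_def intro!: diff_less_Suc[THEN order_less_le_trans])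
  have flip_flip: "flip (flip r) = r" if "r \<in> digits" for r
    using digits_less[OF that] that
    by (auto simp: flip_def digits_def PiE_iff extensional_def fun_eq_iff less_eq_Suc_le)
  have flip_add: "digits_value r + digits_value (flip r) = max_residue" if "r \<in> digits" for r
  proof -
    have "r i + flip r i = d i - 1" if "i < n" for i
      using digits_less[OF \<open>r \<in> digits\<close> that] that by (simp add: flip_def)
    then show ?thesis
      by (simp add: digits_value_def max_residue_def flip: sum.distrib distrib_left)
  qed
  have "(\<Sum>r\<in>digits. digits_value (flip r)) = (\<Sum>r\<in>digits. digits_value r)"
    by (rule sum.reindex_bij_witness[of _ flip flip]) (simp_all add: flip_digits flip_flip)
  then have "2 * (\<Sum>r\<in>digits. digits_value r) = (\<Sum>r\<in>digits. digits_value r + digits_value (flip r))"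
    by (simp add: sum.distrib)
  also have "\<dots> = p * max_residue" by (simp add: flip_add card_digits)
  finally show ?thesis unfolding residues_def by (simp add: sum.reindex[OF inj_on_digits_value])
qed

lemma real_max_residue: "real max_residue = (\<Sum>i<n. real (a ! i) * (real (d i) - 1))"
  unfolding max_residue_def of_nat_sum
  by (intro sum.cong refl) (use d_pos in \<open>simp add: of_nat_diff Suc_leI\<close>)

context
  fixes s assumes pivot: "pivot (nrep reduced_vector) s" and s_pos: "s > 0"
begin

lemma g_eq_value: "g_eq a (nrep a (s * p)) = s * p + max_residue"
  by (simp add: g_eq_def Max_level_set[OF pivot s_pos] Max_residues)

lemma g_le_value: "g_le a (nrep a (s * p)) = s * p + max_residue"
  by (simp add: g_le_def Max_sublevel_set[OF pivot s_pos] Max_residues)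

lemma h_eq_value: "h_eq a (nrep a (s * p)) = s * p"
  by (simp add: h_eq_def Least_level_set[OF pivot s_pos])

lemma h_ge_value: "h_ge a (nrep a (s * p)) = s * p"
  by (simp add: h_ge_def Least_superlevel_set[OF pivot s_pos])

lemma c_eq_value: "c_eq a (nrep a (s * p)) = p"
  by (simp add: c_eq_def level_set_eq[OF pivot s_pos] card_block)

lemma c_le_value: "c_le a (nrep a (s * p)) = s * p + (card gaps + p)"
  by (simp add: c_le_def sublevel_set_eq[OF pivot s_pos] card_gaps_Un_blocks)

lemma s_eq_value:
  "real (s_eq a (nrep a (s * p)))
    = real s * (real p)\<^sup>2 + (\<Sum>i<n. real p * real (a ! i) * (real (d i) - 1) / 2)"
proof -
  have "2 * s_eq a (nrep a (s * p)) = 2 * s * p\<^sup>2 + p * max_residue"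
    by (simp add: s_eq_def level_set_eq[OF pivot s_pos] sum_block twice_sum_residues
        add_mult_distrib2 power2_eq_square)
  then have "real (2 * s_eq a (nrep a (s * p))) = real (2 * s * p\<^sup>2 + p * max_residue)" by simp
  moreover have "(\<Sum>i<n. real p * real (a ! i) * (real (d i) - 1) / 2) = real p * real max_residue / 2"
    by (simp add: real_max_residue sum_distrib_left sum_divide_distrib mult.assoc)
  ultimately show ?thesis by simp
qed

lemma s_le_value:
  "real (s_le a (nrep a (s * p))) = 1 / 2 * (real s * real p)\<^sup>2
    + ((real p + (\<Sum>i<n. real (a ! i) * (real (d i) - 1))) / 2) * (real s * real p)
    + real (\<Sum>gaps + \<Sum>residues)"
proof -
  have "2 * s_le a (nrep a (s * p))
      = (s * p)\<^sup>2 + p * (s * p) + s * (2 * \<Sum>residues) + 2 * (\<Sum>gaps + \<Sum>residues)"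
    by (simp add: s_le_def sublevel_set_eq[OF pivot s_pos] twice_sum_gaps_Un_blocks)
  then have "2 * s_le a (nrep a (s * p))
      = (s * p)\<^sup>2 + (p + max_residue) * (s * p) + 2 * (\<Sum>gaps + \<Sum>residues)"
    unfolding twice_sum_residues by (simp add: algebra_simps)
  then have "real (2 * s_le a (nrep a (s * p)))
      = real ((s * p)\<^sup>2 + (p + max_residue) * (s * p) + 2 * (\<Sum>gaps + \<Sum>residues))" by simp
  then show ?thesis unfolding real_max_residue[symmetric] by (simp add: field_simps)
qed

lemma F_eq_value:
  "F_eq a (nrep a (s * p))
    = fps_X ^ (s * p) * (\<Prod>i<n. (1 - fps_X ^ (d i * a ! i)) / (1 - fps_X ^ (a ! i)))"
  using indicator_fps_block[of s] level_set_eq[OF pivot s_pos]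
  by (simp add: F_eq_eq_indicator_fps indicator_fps_residues)

lemma F_ge_value:
  "F_ge a (nrep a (s * p)) = fps_X ^ (s * p) / (1 - fps_X ^ p)
    * (\<Prod>i<n. (1 - fps_X ^ (d i * a ! i)) / (1 - fps_X ^ (a ! i)))"
  using indicator_fps_blocks_from[of s] superlevel_set_eq[OF pivot s_pos]
  by (simp add: F_ge_eq_indicator_fps indicator_fps_residues)

end

end

theorem theorem1p12:
  fixes a :: "nat list" and n p :: nat and d :: "nat \<Rightarrow> nat"
  assumes "length a = n" and "n \<ge> 2"
    and "\<forall>i<n. a ! i > 0"
    and "Gcd (set a) = 1"
    and "\<forall>i<n. d i = Gcd (set (omit i a))"
    and "p = (\<Prod>i<n. d i)"
  shows "\<exists>C\<^sub>1 C\<^sub>2 :: real. \<forall>\<^sub>F s :: nat in sequentially. let k = nrep a (s * p) in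
      finite {t. nrep a t \<le> k}
    \<and> g_eq a k = g_le a k
    \<and> real (g_le a k) = real s * real p + (\<Sum>i<n. (real (d i) - 1) * real (a ! i))
    \<and> h_eq a k = h_ge a k
    \<and> h_ge a k = s * p
    \<and> c_eq a k = p
    \<and> real (c_le a k) = real s * real p + C\<^sub>1
    \<and> real (s_eq a k) = real s * (real p)\<^sup>2
        + (\<Sum>i<n. real p * real (a ! i) * (real (d i) - 1) / 2)
    \<and> real (s_le a k) = 1 / 2 * (real s * real p)\<^sup>2
        + ((real p + (\<Sum>i<n. real (a ! i) * (real (d i) - 1))) / 2) * (real s * real p) + C\<^sub>2
    \<and> F_eq a k = fps_X ^ (s * p)
        * (\<Prod>i<n. (1 - fps_X ^ (d i * a ! i)) / (1 - fps_X ^ (a ! i)))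
    \<and> F_ge a k = fps_X ^ (s * p) / (1 - fps_X ^ p)
        * (\<Prod>i<n. (1 - fps_X ^ (d i * a ! i)) / (1 - fps_X ^ (a ! i)))"
proof -
  interpret coprime_vector a n p d using assms by unfold_locales
  have pivots: "\<forall>\<^sub>F s in sequentially. pivot (nrep reduced_vector) s \<and> s > 0"
    using nrep_reduced_vector_eventually_strict_increasing
    by (intro eventually_conj eventually_pivot eventually_gt_at_top)
  show ?thesis
  proof (rule exI[of _ "real (card gaps + p)"], rule exI[of _ "real (\<Sum>gaps + \<Sum>residues)"],
      use pivots in eventually_elim)
    case (elim s)
    then have pivot: "pivot (nrep reduced_vector) s" "s > 0" by auto
    have "(\<Sum>i<n. (real (d i) - 1) * real (a ! i)) = real max_residue"
      by (simp add: real_max_residue mult.commute)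
    then show ?case
      unfolding Let_def g_eq_value[OF pivot] g_le_value[OF pivot] h_eq_value[OF pivot]
        h_ge_value[OF pivot] c_eq_value[OF pivot] c_le_value[OF pivot] s_eq_value[OF pivot]
        s_le_value[OF pivot] F_eq_value[OF pivot] F_ge_value[OF pivot]
      using finite_sublevel_set[OF pivot] by simp
  qed
qed

end
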